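(* Let $A=(a_{i_1\cdots i_m\bar{j}_1\cdots \bar{j}_m})$ be a $2m$-th order $n$-dimensional complex tensor, and let $\sigma_h(A)$ be the set of all $\hat{H}$-eigenvalues of $A$. Then $K_{ger}(A)$, $K_{llk}(A)$ and $K_{ll}(A)$ are all inclusion sets for the $\hat{H}$-eigenvalues of $A$ (that is, each contains $\sigma_h(A)$). More precisely, $$\sigma_h(A)\subseteq K_{ll}(A)\subseteq K_{llk}(A)\subseteq K_{ger}(A).$$
   Context: A $2m$-th order $n$-dimensional complex tensor is an array $A=(a_{i_1\cdots i_m\bar{j}_1\cdots \bar{j}_m})$ of complex numbers indexed by $1\le i_1,\dots,i_m,j_1,\dots,j_m\le n$ (the bars on the last $m$ indices are only notation). $\lambda\in\mathbb{C}$ is an $\hat{H}$-eigenvalue of $A$ if there is $\mathbf{x}=(x_1,\dots,x_n)^T\in\mathbb{C}^n\setminus\{0\}$ such that for all $1\le i\le n$, $\sum_{i_2,\dots,i_m,j_1,\dots,j_m=1}^n a_{ii_2\cdots i_m\bar{j}_1\cdots\bar{j}_m}x_{i_2}\cdots x_{i_m}\overline{x_{j_1}}\cdots\overline{x_{j_m}}=\lambda\,\bar{x}_i|x_i|^{2m-2}$ (with $|x_i|^0=1$ when $m=1$). For $1\le i\le n$ let $\Delta_i$ be the set of index tuples $(i_2,\dots,i_m,j_1,\dots,j_m)\in\{1,\dots,n\}^{2m-1}$ different from $(i,\dots,i)$; let $\Delta_i'\subseteq\Delta_i$ be the set of tuples none of whose entries equals $i$; and let $\hat\Delta_i=\Delta_i\setminus\Delta_i'$.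 Define $r_i(A)$, $r_i'(A)$, $\hat r_i(A)$ as the sums of $|a_{ii_2\cdots i_m\bar{j}_1\cdots\bar{j}_m}|$ over $(i_2,\dots,i_m,j_1,\dots,j_m)$ in $\Delta_i$, $\Delta_i'$, $\hat\Delta_i$ respectively. For $i\ne j$ put $r_i^j(A)=r_i(A)-|a_{ij\cdots j\bar{j}\cdots\bar{j}}|$. Define $$K_{ger}(A)=\bigcup_{i=1}^n\{\lambda\in\mathbb{C}:|\lambda-a_{i\cdots i\bar{i}\cdots\bar{i}}|\le r_i(A)\},$$ $$K_{llk}(A)=\bigcup_{i,j=1,\,i\ne j}^n\{\lambda\in\mathbb{C}:(|\lambda-a_{i\cdots i\bar{i}\cdots\bar{i}}|-r_i^j(A))\,|\lambda-a_{j\cdots j\bar{j}\cdots\bar{j}}|\le|a_{ij\cdots j\bar{j}\cdots\bar{j}}|\,r_j(A)\},$$ $$K_{ll}(A)=\bigcup_{i,j=1,\,i\ne j}^n\{\lambda\in\mathbb{C}:(|\lambda-a_{i\cdots i\bar{i}\cdots\bar{i}}|-\hat r_i(A))\,|\lambda-a_{j\cdots j\bar{j}\cdots\bar{j}}|\le r_i'(A)\,r_j(A)\}.$$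
   Formalization: The dimension n is assumed to be at least 2: for n = 1 the unions over i ≠ j defining K_ll(A) and K_llk(A) are empty, while the single entry of A is an Ĥ-eigenvalue, so the claimed inclusions fail. *)

theory Defs
  imports "HOL-Analysis.Analysis"
begin

text \<open>A tensor of order \<open>2m\<close> and dimension \<open>n = CARD('n)\<close> is a function of two index lists: the
  unbarred indices \<open>[i\<^sub>1, \<dots>, i\<^sub>m]\<close> and the barred indices \<open>[j\<^sub>1, \<dots>, j\<^sub>m]\<close>.  The list type does not
  record the order \<open>m\<close>, so it is passed to every notion below as a separate argument; only the
  entries whose two lists have length \<open>m\<close> are ever used.\<close>

type_synonym 'n tensor = "'n list \<Rightarrow> 'n list \<Rightarrow> complex"

text \<open>The tuples \<open>(i\<^sub>2, \<dots>, i\<^sub>m, j\<^sub>1, \<dots>, j\<^sub>m)\<close>, split before \<open>j\<^sub>1\<close>; meaningful for \<open>m \<ge> 1\<close>.\<close>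

definition index_tuples :: "nat \<Rightarrow> ('n list \<times> 'n list) set" where
  "index_tuples m = {(is, js). length is = m - 1 \<and> length js = m}"

lemma finite_index_tuples: "finite (index_tuples m :: ('n::finite list \<times> 'n list) set)"
proof -
  have "finite {xs :: 'n list. length xs = k}" for k
    using finite_lists_length_eq[of "UNIV :: 'n set" k] by simp
  moreover have "index_tuples m = {is :: 'n list. length is = m - 1} \<times> {js. length js = m}"
    by (auto simp: index_tuples_def)
  ultimately show ?thesis by simp
qed

text \<open>The entry with first index \<open>i\<close> and all \<open>2m - 1\<close> remaining indices equal to \<open>j\<close>.\<close>

definition entry :: "nat \<Rightarrow> 'n tensor \<Rightarrow> 'n \<Rightarrow> 'n \<Rightarrow> complex" where
  "entry m A i j = A (i # replicate (m - 1) j) (replicate m j)"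

definition H_hat_eigenvalue :: "nat \<Rightarrow> 'n::finite tensor \<Rightarrow> complex \<Rightarrow> bool" where
  "H_hat_eigenvalue m A \<mu> \<longleftrightarrow>
    (\<exists>x :: complex ^ 'n. x \<noteq> 0 \<and>
      (\<forall>i. (\<Sum>(is, js) \<in> index_tuples m.
              A (i # is) js * (\<Prod>k\<leftarrow>is. x $ k) * (\<Prod>k\<leftarrow>js. cnj (x $ k)))
            = \<mu> * cnj (x $ i) * complex_of_real (cmod (x $ i) ^ (2 * m - 2))))"

definition H_spectrum :: "nat \<Rightarrow> 'n::finite tensor \<Rightarrow> complex set" where
  "H_spectrum m A = {\<mu>. H_hat_eigenvalue m A \<mu>}"

definition \<Delta> :: "nat \<Rightarrow> 'n \<Rightarrow> ('n list \<times> 'n list) set" where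
  "\<Delta> m i = index_tuples m - {(replicate (m - 1) i, replicate m i)}"

definition \<Delta>_prime :: "nat \<Rightarrow> 'n \<Rightarrow> ('n list \<times> 'n list) set" where
  "\<Delta>_prime m i = {(is, js) \<in> \<Delta> m i. i \<notin> set is \<and> i \<notin> set js}"

definition \<Delta>_hat :: "nat \<Rightarrow> 'n \<Rightarrow> ('n list \<times> 'n list) set" where
  "\<Delta>_hat m i = \<Delta> m i - \<Delta>_prime m i"

definition r_full :: "nat \<Rightarrow> 'n tensor \<Rightarrow> 'n \<Rightarrow> real" where
  "r_full m A i = (\<Sum>(is, js) \<in> \<Delta> m i. cmod (A (i # is) js))"

definition r_prime :: "nat \<Rightarrow> 'n tensor \<Rightarrow> 'n \<Rightarrow> real" where
  "r_prime m A i = (\<Sum>(is, js) \<in> \<Delta>_prime m i. cmod (A (i # is) js))"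

definition r_hat :: "nat \<Rightarrow> 'n tensor \<Rightarrow> 'n \<Rightarrow> real" where
  "r_hat m A i = (\<Sum>(is, js) \<in> \<Delta>_hat m i. cmod (A (i # is) js))"

text \<open>\<open>r\<^sub>i\<^sup>j(A)\<close>, only used for \<open>i \<noteq> j\<close>.\<close>

definition r_minus :: "nat \<Rightarrow> 'n tensor \<Rightarrow> 'n \<Rightarrow> 'n \<Rightarrow> real" where
  "r_minus m A i j = r_full m A i - cmod (entry m A i j)"

definition K_ger :: "nat \<Rightarrow> 'n tensor \<Rightarrow> complex set" where
  "K_ger m A = (\<Union>i. {\<mu>. cmod (\<mu> - entry m A i i) \<le> r_full m A i})"

definition K_llk :: "nat \<Rightarrow> 'n tensor \<Rightarrow> complex set" where
  "K_llk m A = (\<Union>(i, j) \<in> {(i, j). i \<noteq> j}.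
     {\<mu>. (cmod (\<mu> - entry m A i i) - r_minus m A i j) * cmod (\<mu> - entry m A j j)
          \<le> cmod (entry m A i j) * r_full m A j})"

definition K_ll :: "nat \<Rightarrow> 'n tensor \<Rightarrow> complex set" where
  "K_ll m A = (\<Union>(i, j) \<in> {(i, j). i \<noteq> j}.
     {\<mu>. (cmod (\<mu> - entry m A i i) - r_hat m A i) * cmod (\<mu> - entry m A j j)
          \<le> r_prime m A i * r_full m A j})"

end

theory Submission
  imports Defs
begin

text \<open>Let \<open>x\<close> be an eigenvector, \<open>|x\<^sub>p|\<close> its largest modulus and \<open>|x\<^sub>q|\<close> the largest one among the
  indices different from \<open>p\<close>.  In the \<open>p\<close>-th equation the tuples avoiding \<open>p\<close> are bounded by
  \<open>|x\<^sub>q|\<^sup>2\<^sup>m\<^sup>-\<^sup>1\<close> and the others by \<open>|x\<^sub>p|\<^sup>2\<^sup>m\<^sup>-\<^sup>1\<close>; multiplying with the Gershgorin bound of the \<open>q\<close>-th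
  equation puts the eigenvalue in the component \<open>(p, q)\<close> of \<open>K_ll\<close>.

  For the other inclusions write \<open>a = |\<mu> - a\<^sub>i\<^sub>i|\<close>, \<open>b = |\<mu> - a\<^sub>j\<^sub>j|\<close>.  The components of \<open>K_ll\<close> and
  \<open>K_llk\<close> read \<open>(a - r\<^sub>i) b \<le> c (r\<^sub>j - b)\<close>, where \<open>c\<close> is \<open>r_prime\<close> for the former and the
  smaller \<open>|a\<^sub>i\<^sub>j|\<close> for the latter.  If \<open>b > r\<^sub>j\<close> or \<open>a \<le> r\<^sub>i\<close>, decreasing \<open>c\<close> keeps this inequality;
  otherwise \<open>a b \<le> r\<^sub>i r\<^sub>j\<close>, which gives the component \<open>(j, i)\<close> of \<open>K_llk\<close>.\<close>

lemma prod_list_le_power: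
  fixes f :: "'a \<Rightarrow> real"
  assumes "\<And>k. k \<in> set xs \<Longrightarrow> 0 \<le> f k \<and> f k \<le> B"
  shows "prod_list (map f xs) \<le> B ^ length xs"
  using assms
proof (induction xs)
  case (Cons y ys)
  have "0 \<le> prod_list (map f ys)"
    using Cons.prems by (intro prod_list_nonneg) auto
  moreover have "0 \<le> f y" "f y \<le> B" "prod_list (map f ys) \<le> B ^ length ys"
    using Cons by auto
  ultimately show ?case by (simp add: mult_mono)
qed simp

lemma cmod_prod_list: "cmod (\<Prod>k\<leftarrow>xs. f k) = (\<Prod>k\<leftarrow>xs. cmod (f k))"
  by (induction xs) (simp_all add: norm_mult)

text \<open>Every monomial has \<open>(m - 1) + m = 2 * m - 1\<close> factors, each of modulus at
  most \<open>B\<close>. The set \<open>S\<close> is left free so that different bounds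
  \<open>B\<close> can be used on \<open>\<Delta>_hat\<close>, \<open>\<Delta>_prime\<close> and
  \<open>\<Delta>\<close>.\<close>

lemma cmod_row_sum_le:
  fixes A :: "'n::finite tensor" and x :: "complex ^ 'n"
  assumes "m \<ge> 1" and S: "S \<subseteq> index_tuples m"
    and B: "\<And>is js k. (is, js) \<in> S \<Longrightarrow> k \<in> set is \<union> set js \<Longrightarrow> cmod (x $ k) \<le> B"
  shows "cmod (\<Sum>(is, js) \<in> S. A (i # is) js * (\<Prod>k\<leftarrow>is. x $ k) * (\<Prod>k\<leftarrow>js. cnj (x $ k)))
    \<le> (\<Sum>(is, js) \<in> S. cmod (A (i # is) js)) * B ^ (2 * m - 1)"
  unfolding sum_distrib_right
proof (rule sum_norm_le)
  fix t assume t: "t \<in> S"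
  obtain "is" js where t_eq: "t = (is, js)" by (cases t)
  have len: "length (is @ js) = 2 * m - 1"
    using t S assms(1) by (auto simp: t_eq index_tuples_def)
  have "cmod ((\<Prod>k\<leftarrow>is. x $ k) * (\<Prod>k\<leftarrow>js. cnj (x $ k))) = (\<Prod>k\<leftarrow>is @ js. cmod (x $ k))"
    by (simp add: norm_mult cmod_prod_list)
  also have "\<dots> \<le> B ^ length (is @ js)"
    using t B by (intro prod_list_le_power) (auto simp: t_eq)
  finally show "cmod (case t of (is, js) \<Rightarrow>
        A (i # is) js * (\<Prod>k\<leftarrow>is. x $ k) * (\<Prod>k\<leftarrow>js. cnj (x $ k)))
      \<le> (case t of (is, js) \<Rightarrow> cmod (A (i # is) js)) * B ^ (2 * m - 1)"
    unfolding len by (simp add: t_eq norm_mult mult.assoc mult_left_mono)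
qed

lemma \<Delta>_subset: "\<Delta> m i \<subseteq> index_tuples m"
  and \<Delta>_prime_subset: "\<Delta>_prime m i \<subseteq> \<Delta> m i"
  and \<Delta>_hat_subset: "\<Delta>_hat m i \<subseteq> \<Delta> m i"
  by (auto simp: \<Delta>_def \<Delta>_prime_def \<Delta>_hat_def)

lemma finite_\<Delta>: "finite (\<Delta> m (i :: 'n::finite))"
  using finite_index_tuples \<Delta>_subset by (rule finite_subset[rotated])

lemma sum_\<Delta>_split:
  fixes f :: "'n::finite list \<times> 'n list \<Rightarrow> 'b::comm_monoid_add"
  shows "sum f (\<Delta> m i) = sum f (\<Delta>_hat m i) + sum f (\<Delta>_prime m i)"
  unfolding \<Delta>_hat_def by (rule sum.subset_diff[OF \<Delta>_prime_subset finite_\<Delta>])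

lemma r_full_eq: "r_full m (A :: 'n::finite tensor) i = r_hat m A i + r_prime m A i"
  by (simp add: r_full_def r_hat_def r_prime_def sum_\<Delta>_split)

lemma r_nonneg: "0 \<le> r_full m A i" "0 \<le> r_prime m A i" "0 \<le> r_hat m A i"
  by (auto simp: r_full_def r_hat_def r_prime_def intro!: sum_nonneg)

text \<open>The entry is a single term of \<open>r_prime\<close>: the constant tuple of
  \<open>j\<close> avoids \<open>i\<close>, and \<open>m \<ge> 1\<close> makes its barred part
  nonempty, hence different from that of the excluded diagonal tuple.\<close>

lemma cmod_entry_le_r_prime:
  fixes A :: "'n::finite tensor"
  assumes "m \<ge> 1" "i \<noteq> j"
  shows "cmod (entry m A i j) \<le> r_prime m A i"
proof -
  let ?f = "\<lambda>(is, js). cmod (A (i # is) js)"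
  have "(replicate (m - 1) j, replicate m j) \<in> \<Delta>_prime m i"
    using assms by (cases m) (auto simp: \<Delta>_prime_def \<Delta>_def index_tuples_def)
  moreover have "finite (\<Delta>_prime m i)"
    using finite_\<Delta> \<Delta>_prime_subset by (rule finite_subset[rotated])
  ultimately have "?f (replicate (m - 1) j, replicate m j) \<le> sum ?f (\<Delta>_prime m i)"
    by (intro member_le_sum) auto
  then show ?thesis by (simp add: entry_def r_prime_def)
qed

text \<open>The diagonal monomial carries the same factor as \<open>\<mu>\<close>, because
  \<open>z ^ (m - 1) * cnj z ^ m\<close> is \<open>cnj z\<close> times the power
  \<open>2 * m - 2\<close> of the modulus of \<open>z\<close>. Moving it to the right-hand side
  leaves the sum over \<open>\<Delta>\<close>.\<close>

lemma eigenvalue_equation_\<Delta>: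
  fixes A :: "'n::finite tensor" and x :: "complex ^ 'n"
  assumes "m \<ge> 1"
    and eq: "(\<Sum>(is, js) \<in> index_tuples m.
              A (i # is) js * (\<Prod>k\<leftarrow>is. x $ k) * (\<Prod>k\<leftarrow>js. cnj (x $ k)))
            = \<mu> * cnj (x $ i) * complex_of_real (cmod (x $ i) ^ (2 * m - 2))"
  shows "cmod (\<mu> - entry m A i i) * cmod (x $ i) ^ (2 * m - 1) =
    cmod (\<Sum>(is, js) \<in> \<Delta> m i. A (i # is) js * (\<Prod>k\<leftarrow>is. x $ k) * (\<Prod>k\<leftarrow>js. cnj (x $ k)))"
proof -
  let ?f = "\<lambda>(is, js). A (i # is) js * (\<Prod>k\<leftarrow>is. x $ k) * (\<Prod>k\<leftarrow>js. cnj (x $ k))"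
  \<comment> \<open>With \<open>m = Suc k\<close>, the truncated differences \<open>m - 1\<close>
    and \<open>2 * m - 2\<close> become \<open>k\<close> and \<open>2 * k\<close>.\<close>
  obtain k where m: "m = Suc k" using assms(1) by (cases m) auto
  let ?d = "(replicate k i, replicate (Suc k) i)"
  have "(x $ i) ^ k * cnj (x $ i) ^ k = complex_of_real (cmod (x $ i) ^ (2 * k))"
    by (metis complex_norm_square of_real_power power_mult power_mult_distrib)
  then have d: "?f ?d = entry m A i i * cnj (x $ i) * complex_of_real (cmod (x $ i) ^ (2 * k))"
    by (simp add: entry_def m ac_simps)
  have "?d \<in> index_tuples m" by (simp add: index_tuples_def m)
  then have "sum ?f (index_tuples m) = ?f ?d + sum ?f (\<Delta> m i)"
    using sum.remove[OF finite_index_tuples, of ?d m ?f] by (simp add: \<Delta>_def m)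
  then have "sum ?f (\<Delta> m i) =
      (\<mu> - entry m A i i) * cnj (x $ i) * complex_of_real (cmod (x $ i) ^ (2 * k))"
    unfolding d eq by (simp add: m algebra_simps)
  then show ?thesis by (simp add: m norm_mult norm_power)
qed

lemma obtain_argmax:
  fixes f :: "'a \<Rightarrow> real"
  assumes "finite S" "S \<noteq> {}"
  obtains p where "p \<in> S" "\<And>k. k \<in> S \<Longrightarrow> f k \<le> f p"
proof -
  have "Max (f ` S) \<in> f ` S" using assms by simp
  then obtain p where "p \<in> S" "f p = Max (f ` S)" by auto
  then show thesis using assms(1) that by simp
qed

lemma H_spectrum_subset_K_ll:
  fixes A :: "'n::finite tensor"
  assumes m: "m \<ge> 1" and n: "CARD('n) \<ge> 2"
  shows "H_spectrum m A \<subseteq> K_ll m A"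
proof
  fix \<mu> assume "\<mu> \<in> H_spectrum m A"
  then obtain x :: "complex ^ 'n" where x0: "x \<noteq> 0" and
    eq: "\<And>i. (\<Sum>(is, js) \<in> index_tuples m.
              A (i # is) js * (\<Prod>k\<leftarrow>is. x $ k) * (\<Prod>k\<leftarrow>js. cnj (x $ k)))
            = \<mu> * cnj (x $ i) * complex_of_real (cmod (x $ i) ^ (2 * m - 2))"
    by (auto simp: H_spectrum_def H_hat_eigenvalue_def)
  let ?f = "\<lambda>i (is, js). A (i # is) js * (\<Prod>k\<leftarrow>is. x $ k) * (\<Prod>k\<leftarrow>js. cnj (x $ k))"
  obtain p where p: "\<And>k. cmod (x $ k) \<le> cmod (x $ p)"
    using obtain_argmax[of "UNIV :: 'n set" "\<lambda>k. cmod (x $ k)"] by auto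
  \<comment> \<open>The second largest modulus needs an index other than \<open>p\<close>.\<close>
  have "UNIV \<noteq> {p}"
  proof
    assume "UNIV = {p}"
    then have "CARD('n) = card {p}" by simp
    then show False using n by simp
  qed
  then have "- {p} \<noteq> {}" by auto
  then obtain q where q: "q \<noteq> p" "\<And>k. k \<noteq> p \<Longrightarrow> cmod (x $ k) \<le> cmod (x $ q)"
    using obtain_argmax[of "- {p}" "\<lambda>k. cmod (x $ k)"] by auto
  define X where "X = cmod (x $ p) ^ (2 * m - 1)"
  define Y where "Y = cmod (x $ q) ^ (2 * m - 1)"
  define a where "a = cmod (\<mu> - entry m A p p)"
  define b where "b = cmod (\<mu> - entry m A q q)"
  have "x $ p \<noteq> 0"
  proof
    assume "x $ p = 0"
    then have "x $ k = 0" for k using p[of k] by simp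
    then show False using x0 by (simp add: vec_eq_iff)
  qed
  then have X: "X > 0" by (simp add: X_def)
  have Y: "Y \<ge> 0" by (simp add: Y_def)
  have "a * X = cmod (sum (?f p) (\<Delta>_hat m p) + sum (?f p) (\<Delta>_prime m p))"
    using eigenvalue_equation_\<Delta>[OF m eq] by (simp add: a_def X_def sum_\<Delta>_split)
  also have "\<dots> \<le> cmod (sum (?f p) (\<Delta>_hat m p)) + cmod (sum (?f p) (\<Delta>_prime m p))"
    by (rule norm_triangle_ineq)
  also have "\<dots> \<le> r_hat m A p * X + r_prime m A p * Y"
    unfolding r_hat_def r_prime_def X_def Y_def
  proof (intro add_mono cmod_row_sum_le m)
    fix "is" js k assume "(is, js) \<in> \<Delta>_prime m p" "k \<in> set is \<union> set js"
    then show "cmod (x $ k) \<le> cmod (x $ q)"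
      by (intro q) (auto simp: \<Delta>_prime_def)
  qed (auto simp: \<Delta>_hat_def \<Delta>_prime_def \<Delta>_def p)
  finally have row_p: "(a - r_hat m A p) * X \<le> r_prime m A p * Y"
    by (simp add: algebra_simps)
  have "b * Y = cmod (sum (?f q) (\<Delta> m q))"
    using eigenvalue_equation_\<Delta>[OF m eq] by (simp add: b_def Y_def)
  \<comment> \<open>Tuples in \<open>\<Delta> m q\<close> may contain \<open>p\<close>, so the bound
    is \<open>X\<close> and not \<open>Y\<close>.\<close>
  also have "\<dots> \<le> r_full m A q * X"
    unfolding r_full_def X_def by (intro cmod_row_sum_le m \<Delta>_subset p)
  finally have row_q: "b * Y \<le> r_full m A q * X" .
  have b: "b \<ge> 0" by (simp add: b_def)
  have "(a - r_hat m A p) * b \<le> r_prime m A p * r_full m A q"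
  proof (cases "a \<le> r_hat m A p")
    case True
    then have "(a - r_hat m A p) * b \<le> 0" using b by (simp add: mult_nonpos_nonneg)
    also have "0 \<le> r_prime m A p * r_full m A q" by (simp add: r_nonneg)
    finally show ?thesis .
  next
    case False
    \<comment> \<open>Multiplying \<open>row_p\<close> by \<open>b\<close> lets \<open>row_q\<close>
      absorb \<open>Y\<close>. Only \<open>X > 0\<close> is then cancelled, so \<open>Y = 0\<close>
      needs no separate treatment.\<close>
    have "((a - r_hat m A p) * b) * X = ((a - r_hat m A p) * X) * b" by simp
    also have "\<dots> \<le> (r_prime m A p * Y) * b" using row_p b by (rule mult_right_mono)
    also have "\<dots> = r_prime m A p * (b * Y)" by simp
    also have "\<dots> \<le> r_prime m A p * (r_full m A q * X)"
      using row_q r_nonneg(2) by (rule mult_left_mono)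
    finally show ?thesis using X by (simp flip: mult.assoc)
  qed
  then show "\<mu> \<in> K_ll m A" using q(1) unfolding K_ll_def a_def b_def by blast
qed

lemma K_ll_subset_K_llk:
  fixes A :: "'n::finite tensor"
  assumes m: "m \<ge> 1"
  shows "K_ll m A \<subseteq> K_llk m A"
proof
  fix \<mu> assume "\<mu> \<in> K_ll m A"
  then obtain i j where ij: "i \<noteq> j" and
    le: "(cmod (\<mu> - entry m A i i) - r_hat m A i) * cmod (\<mu> - entry m A j j)
          \<le> r_prime m A i * r_full m A j"
    by (auto simp: K_ll_def)
  define a where "a = cmod (\<mu> - entry m A i i)"
  define b where "b = cmod (\<mu> - entry m A j j)"
  let ?ri = "r_full m A i" and ?rj = "r_full m A j" and ?R = "r_prime m A i"
    and ?c = "cmod (entry m A i j)" and ?d = "cmod (entry m A j i)"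
  have le': "(a - ?ri) * b \<le> ?R * (?rj - b)"
    using le by (simp add: a_def b_def r_full_eq algebra_simps)
  have c: "?c \<le> ?R" using m ij by (rule cmod_entry_le_r_prime)
  have d: "?d \<le> ?rj"
    using cmod_entry_le_r_prime[OF m, of j i A] ij r_nonneg(3)[of m A j] by (simp add: r_full_eq)
  have R: "?R \<le> ?ri" using r_nonneg(3)[of m A i] by (simp add: r_full_eq)
  have b: "b \<ge> 0" by (simp add: b_def)
  have "(a - ?ri) * b \<le> ?c * (?rj - b) \<or> (b - ?rj) * a \<le> ?d * (?ri - a)"
  proof (cases "b \<le> ?rj")
    case False
    then have "?R * (?rj - b) \<le> ?c * (?rj - b)" using c by (intro mult_right_mono_neg) auto
    then show ?thesis using le' by simp
  next
    case bj: True
    show ?thesis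
    proof (cases "a \<le> ?ri")
      case True
      then have "(a - ?ri) * b \<le> 0" using b by (simp add: mult_nonpos_nonneg)
      also have "0 \<le> ?c * (?rj - b)" using bj by simp
      finally show ?thesis ..
    next
      case False
      \<comment> \<open>Rearranged, \<open>le'\<close> reads
        \<open>a * b \<le> (?ri - ?R) * b + ?R * ?rj\<close>; replacing \<open>b\<close> by
        \<open>?rj\<close> collapses the right-hand side to \<open>?ri * ?rj\<close>.\<close>
      have "(?ri - ?R) * b \<le> (?ri - ?R) * ?rj" using bj R by (intro mult_left_mono) auto
      then have "a * b \<le> ?ri * ?rj" using le' by (simp add: algebra_simps)
      \<comment> \<open>Hence \<open>(b - ?rj) * a \<le> ?rj * (?ri - a)\<close>, and since
        \<open>?ri - a\<close> is negative, lowering the coefficient \<open>?rj\<close> to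
        \<open>?d\<close> only enlarges the right-hand side.\<close>
      moreover have "?d * (a - ?ri) \<le> ?rj * (a - ?ri)"
        using d False by (intro mult_right_mono) auto
      ultimately show ?thesis by (simp add: algebra_simps)
    qed
  qed
  then have "(a - r_minus m A i j) * b \<le> ?c * ?rj \<or> (b - r_minus m A j i) * a \<le> ?d * ?ri"
    by (simp add: r_minus_def algebra_simps)
  then show "\<mu> \<in> K_llk m A"
    using ij unfolding K_llk_def a_def b_def by blast
qed

text \<open>Outside both Gershgorin discs \<open>i\<close> and \<open>j\<close>, the left-hand side
  of \<open>le'\<close> is positive while its right-hand side is not. So each component
  \<open>(i, j)\<close> lies in the union of these two discs.\<close>

lemma K_llk_subset_K_ger: "K_llk m A \<subseteq> K_ger m A"
proof
  fix \<mu> assume "\<mu> \<in> K_llk m A"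
  then obtain i j where le: "(cmod (\<mu> - entry m A i i) - r_minus m A i j) * cmod (\<mu> - entry m A j j)
          \<le> cmod (entry m A i j) * r_full m A j"
    by (auto simp: K_llk_def)
  define a where "a = cmod (\<mu> - entry m A i i)"
  define b where "b = cmod (\<mu> - entry m A j j)"
  have le': "(a - r_full m A i) * b \<le> cmod (entry m A i j) * (r_full m A j - b)"
    using le by (simp add: a_def b_def r_minus_def algebra_simps)
  have "b \<le> r_full m A j \<or> a \<le> r_full m A i"
  proof (rule disjCI)
    assume "\<not> a \<le> r_full m A i"
    show "b \<le> r_full m A j"
    proof (rule ccontr)
      assume bj: "\<not> b \<le> r_full m A j"
      then have "0 < b" using r_nonneg(1)[of m A j] by linarith
      then have "0 < (a - r_full m A i) * b" using \<open>\<not> a \<le> r_full m A i\<close> by simp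
      also note le'
      also have "cmod (entry m A i j) * (r_full m A j - b) \<le> 0"
        using bj by (intro mult_nonneg_nonpos) auto
      finally show False by simp
    qed
  qed
  then show "\<mu> \<in> K_ger m A" by (auto simp: K_ger_def a_def b_def)
qed

theorem proposition1p5:
  fixes A :: "'n::finite tensor" and m :: nat
  assumes "m \<ge> 1" and "CARD('n) \<ge> 2"
  shows "H_spectrum m A \<subseteq> K_ger m A \<and> H_spectrum m A \<subseteq> K_llk m A
    \<and> H_spectrum m A \<subseteq> K_ll m A \<and> K_ll m A \<subseteq> K_llk m A \<and> K_llk m A \<subseteq> K_ger m A"
  using H_spectrum_subset_K_ll[OF assms, of A] K_ll_subset_K_llk[OF assms(1), of A]
    K_llk_subset_K_ger[of m A]
  by blast

end
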